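(* Let $D$ be a continuous dcpo with a basis $B$. Suppose that at least one of the following conditions holds: (i) for all $a,b\in B$, $\neg\neg(a\ll b)$ implies $a\ll b$; (ii) for all $a,b\in B$, $\neg\neg(a\sqsubseteq b)$ implies $a\sqsubseteq b$; (iii) for all $a,b\in B$ it is decidable whether $a\ll b$; (iv) for all $a,b\in B$ it is decidable whether $a\sqsubseteq b$. Then $\{\twoheaduparrow b \mid b\in B\}$, where $\twoheaduparrow b=\{y\in D\mid b\ll y\}$, is a $\neg\neg$-stable basis for the Scott topology on $D$. Consequently, the Scott topology on $D$ coincides with the apartness topology on $D$ with respect to the intrinsic apartness: a subset of $D$ is Scott open if and only if it is nearly open.
   Context: We work constructively: informal set theory without excluded middle or choice axioms. A subset $S$ of a poset is directed if it is inhabited and any two elements of $S$ have an upper bound in $S$. A dcpo is a poset in which every directed subset $S$ has a supremum $\bigsqcup S$. In a dcpo $D$, $x\ll y$ ($x$ is way below $y$) if for every directed $S\subseteq D$ with $y\sqsubseteq\bigsqcup S$ there is $s\in S$ with $x\sqsubseteq s$. A basis of $D$ is a subset $B\subseteq D$ such that for every $x\in D$ the set $\{b\in B\mid b\ll x\}$ is directed with supremum $x$; $D$ is continuous if it has a basis. A subset $U\subseteq D$ is Scott open if it is an upper set and whenever $S$ is directed with $\bigsqcup S\in U$ then some $s\in S$ lies in $U$. A proposition $P$ is decidable if $P\vee\neg P$. For $x,y\in D$ write $x\not\leq_{\mathrm S} y$ if there is a Scott open set containing $x$ but not $y$. The intrinsic apartness is the relation $x\# y$ iff ($x\not\leq_{\mathrm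 S}y$ or $y\not\leq_{\mathrm S}x$). For a subset $A$ of a topological space $X$ with a binary relation $\#$, the logical complement is $\neg A=\{x\in X\mid x\notin A\}$ and the complement is ${\sim}A=\{x\in X\mid \forall y\in A,\ x\# y\}$; $Y^\circ$ denotes the interior of $Y$. The apartness complement of $A$ is $-A=\{x\in X\mid x\in({\sim}A)^\circ\}$; subsets of this form are called nearly open, and the apartness topology on $X$ is the topology having the nearly open subsets as basic opens. A basis $\mathcal B$ of opens of $X$ is $\neg\neg$-stable if $U=(\neg\neg U)^\circ$ for every $U\in\mathcal B$.
   Formalization: In the last clause "nearly open" is read as open in the apartness topology; the literal form −A fails constructively (one-point dcpo) and is stated only for U with U = (¬¬U)°. Constructive truth is rendered as validity in all Heyting-valued sets. *)

theory Defs
  imports Main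
begin

section \<open>Constructive truth values\<close>

text \<open>
  The ambient logic HOL is classical, so that decidability and stability under double negation
  would hold trivially for HOL propositions. The theorem is a statement of constructive
  mathematics; it is therefore interpreted in Heyting-valued sets: propositions take values in
  an arbitrary complete Heyting algebra \<open>'o\<close>, a set is a type with an \<open>'o\<close>-valued equality, and its
  subsets are the extensional \<open>'o\<close>-valued predicates (Fourman and Scott, Sheaves and logic). Neither
  excluded middle nor choice is valid in this interpretation, and the case \<open>'o = bool\<close> is
  ordinary classical mathematics.
\<close>

class complete_heyting = complete_lattice +
  assumes inf_Sup_le_SUP_inf: "inf a (Sup A) \<le> (SUP b\<in>A. inf a b)"

instance bool :: complete_heyting
  by standard auto

definition himp :: "'o::complete_heyting \<Rightarrow> 'o \<Rightarrow> 'o"  (infixr "\<^bold>\<longrightarrow>" 25)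
  where "(p \<^bold>\<longrightarrow> q) = Sup {r. inf r p \<le> q}"

abbreviation hand :: "'o::complete_heyting \<Rightarrow> 'o \<Rightarrow> 'o"  (infixr "\<^bold>\<and>" 35)
  where "p \<^bold>\<and> q \<equiv> inf p q"

abbreviation hor :: "'o::complete_heyting \<Rightarrow> 'o \<Rightarrow> 'o"  (infixr "\<^bold>\<or>" 30)
  where "p \<^bold>\<or> q \<equiv> sup p q"

definition hnot :: "'o::complete_heyting \<Rightarrow> 'o"  ("\<^bold>\<not> _" [40] 40)
  where "(\<^bold>\<not> p) = (p \<^bold>\<longrightarrow> bot)"

definition hiff :: "'o::complete_heyting \<Rightarrow> 'o \<Rightarrow> 'o"  (infixr "\<^bold>\<longleftrightarrow>" 25)
  where "(p \<^bold>\<longleftrightarrow> q) = ((p \<^bold>\<longrightarrow> q) \<^bold>\<and> (q \<^bold>\<longrightarrow> p))"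

definition valid :: "'o::complete_heyting \<Rightarrow> bool"
  where "valid p \<longleftrightarrow> p = top"

definition decidable :: "'o::complete_heyting \<Rightarrow> 'o"
  where "decidable p = (p \<^bold>\<or> \<^bold>\<not> p)"

lemma le_himp_iff: "r \<le> (p \<^bold>\<longrightarrow> q) \<longleftrightarrow> inf r p \<le> q"
proof
  assume "r \<le> (p \<^bold>\<longrightarrow> q)"
  then have "inf r p \<le> inf p (Sup {r. inf r p \<le> q})"
    by (auto simp: himp_def intro: le_infI1)
  also have "\<dots> \<le> (SUP r\<in>{r. inf r p \<le> q}. inf p r)"
    by (rule inf_Sup_le_SUP_inf)
  also have "\<dots> \<le> q"
    by (auto intro!: SUP_least simp: inf_commute)
  finally show "inf r p \<le> q" .
qed (auto simp: himp_def intro: Sup_upper)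

lemma himp_bool: "(P \<^bold>\<longrightarrow> Q) = (P \<longrightarrow> Q)"
  by (auto simp: himp_def)


section \<open>Heyting-valued sets\<close>

text \<open>
  \<open>heq D x y\<close> is the truth value of \<open>x\<close> and \<open>y\<close> being equal elements of \<open>D\<close>, so that
  \<open>heq D x x\<close> is the truth value of \<open>x\<close> being an element of \<open>D\<close>.
\<close>

record ('a, 'o) hstruct =
  heq :: "'a \<Rightarrow> 'a \<Rightarrow> 'o"  (infix "\<approx>\<index>" 50)
  hle :: "'a \<Rightarrow> 'a \<Rightarrow> 'o"  (infix "\<sqsubseteq>\<index>" 50)

definition elements :: "('a, 'o::complete_heyting) hstruct \<Rightarrow> 'a \<Rightarrow> 'o"
  where "elements D x = heq D x x"

text \<open>A Heyting-valued set with a binary relation; the order axioms are internal, see below.\<close>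

definition hstructure :: "('a, 'o::complete_heyting) hstruct \<Rightarrow> bool"
  where "hstructure D \<longleftrightarrow>
    (\<forall>x y. heq D x y \<le> heq D y x) \<and>
    (\<forall>x y z. inf (heq D x y) (heq D y z) \<le> heq D x z) \<and>
    (\<forall>x y. hle D x y \<le> inf (elements D x) (elements D y)) \<and>
    (\<forall>x x' y y'. inf (hle D x y) (inf (heq D x x') (heq D y y')) \<le> hle D x' y')"

definition subsets :: "('a, 'o::complete_heyting) hstruct \<Rightarrow> ('a \<Rightarrow> 'o) set"
  where "subsets D = {S. (\<forall>x. S x \<le> elements D x) \<and> (\<forall>x y. inf (S x) (heq D x y) \<le> S y)}"

definition hball :: "('a \<Rightarrow> 'o::complete_heyting) \<Rightarrow> ('a \<Rightarrow> 'o) \<Rightarrow> 'o"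
  where "hball S P = (INF x. (S x \<^bold>\<longrightarrow> P x))"

definition hbex :: "('a \<Rightarrow> 'o::complete_heyting) \<Rightarrow> ('a \<Rightarrow> 'o) \<Rightarrow> 'o"
  where "hbex S P = (SUP x. (S x \<^bold>\<and> P x))"

definition hcollect :: "('a \<Rightarrow> 'o::complete_heyting) \<Rightarrow> ('a \<Rightarrow> 'o) \<Rightarrow> 'a \<Rightarrow> 'o"
  where "hcollect S P = (\<lambda>x. S x \<^bold>\<and> P x)"

definition hball_sub ::
    "('a, 'o::complete_heyting) hstruct \<Rightarrow> (('a \<Rightarrow> 'o) \<Rightarrow> 'o) \<Rightarrow> 'o"
  where "hball_sub D P = (INF S\<in>subsets D. P S)"

definition hbex_sub ::
    "('a, 'o::complete_heyting) hstruct \<Rightarrow> (('a \<Rightarrow> 'o) \<Rightarrow> 'o) \<Rightarrow> 'o"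
  where "hbex_sub D P = (SUP S\<in>subsets D. P S)"

syntax
  "_hball" :: "pttrn \<Rightarrow> 'b \<Rightarrow> 'c \<Rightarrow> 'c"  ("(3\<^bold>\<forall>_\<^bold>\<in>_./ _)" [0, 0, 10] 10)
  "_hbex" :: "pttrn \<Rightarrow> 'b \<Rightarrow> 'c \<Rightarrow> 'c"  ("(3\<^bold>\<exists>_\<^bold>\<in>_./ _)" [0, 0, 10] 10)
  "_hball_sub" :: "pttrn \<Rightarrow> 'b \<Rightarrow> 'c \<Rightarrow> 'c"  ("(3\<^bold>\<forall>_\<^bold>\<subseteq>_./ _)" [0, 0, 10] 10)
  "_hbex_sub" :: "pttrn \<Rightarrow> 'b \<Rightarrow> 'c \<Rightarrow> 'c"  ("(3\<^bold>\<exists>_\<^bold>\<subseteq>_./ _)" [0, 0, 10] 10)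
  "_hcollect" :: "pttrn \<Rightarrow> 'b \<Rightarrow> 'c \<Rightarrow> 'b"  ("(1\<^bold>{_\<^bold>\<in>_./ _\<^bold>})")
translations
  "\<^bold>\<forall>x\<^bold>\<in>S. P" \<rightleftharpoons> "CONST hball S (\<lambda>x. P)"
  "\<^bold>\<exists>x\<^bold>\<in>S. P" \<rightleftharpoons> "CONST hbex S (\<lambda>x. P)"
  "\<^bold>\<forall>S\<^bold>\<subseteq>D. P" \<rightleftharpoons> "CONST hball_sub D (\<lambda>S. P)"
  "\<^bold>\<exists>S\<^bold>\<subseteq>D. P" \<rightleftharpoons> "CONST hbex_sub D (\<lambda>S. P)"
  "\<^bold>{x\<^bold>\<in>S. P\<^bold>}" \<rightleftharpoons> "CONST hcollect S (\<lambda>x. P)"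

definition hsubset :: "('a \<Rightarrow> 'o::complete_heyting) \<Rightarrow> ('a \<Rightarrow> 'o) \<Rightarrow> 'o"  (infix "\<^bold>\<subseteq>" 50)
  where "S \<^bold>\<subseteq> T = (\<^bold>\<forall>x\<^bold>\<in>S. T x)"

definition hseteq :: "('a \<Rightarrow> 'o::complete_heyting) \<Rightarrow> ('a \<Rightarrow> 'o) \<Rightarrow> 'o"  (infix "\<^bold>=" 50)
  where "S \<^bold>= T = ((S \<^bold>\<subseteq> T) \<^bold>\<and> (T \<^bold>\<subseteq> S))"


section \<open>Continuous dcpos\<close>

definition poset :: "('a, 'o::complete_heyting) hstruct \<Rightarrow> 'o"
  where "poset D =
    ((\<^bold>\<forall>x\<^bold>\<in>elements D. hle D x x) \<^bold>\<and>
     (\<^bold>\<forall>x\<^bold>\<in>elements D. \<^bold>\<forall>y\<^bold>\<in>elements D. \<^bold>\<forall>z\<^bold>\<in>elements D.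
        (hle D x y \<^bold>\<and> hle D y z) \<^bold>\<longrightarrow> hle D x z) \<^bold>\<and>
     (\<^bold>\<forall>x\<^bold>\<in>elements D. \<^bold>\<forall>y\<^bold>\<in>elements D. (hle D x y \<^bold>\<and> hle D y x) \<^bold>\<longrightarrow> heq D x y))"

definition directed :: "('a, 'o::complete_heyting) hstruct \<Rightarrow> ('a \<Rightarrow> 'o) \<Rightarrow> 'o"
  where "directed D S =
    ((\<^bold>\<exists>x\<^bold>\<in>S. top) \<^bold>\<and> (\<^bold>\<forall>x\<^bold>\<in>S. \<^bold>\<forall>y\<^bold>\<in>S. \<^bold>\<exists>z\<^bold>\<in>S. hle D x z \<^bold>\<and> hle D y z))"

definition is_sup :: "('a, 'o::complete_heyting) hstruct \<Rightarrow> ('a \<Rightarrow> 'o) \<Rightarrow> 'a \<Rightarrow> 'o"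
  where "is_sup D S s =
    ((\<^bold>\<forall>x\<^bold>\<in>S. hle D x s) \<^bold>\<and>
     (\<^bold>\<forall>u\<^bold>\<in>elements D. (\<^bold>\<forall>x\<^bold>\<in>S. hle D x u) \<^bold>\<longrightarrow> hle D s u))"

definition dcpo :: "('a, 'o::complete_heyting) hstruct \<Rightarrow> 'o"
  where "dcpo D =
    (poset D \<^bold>\<and> (\<^bold>\<forall>S\<^bold>\<subseteq>D. directed D S \<^bold>\<longrightarrow> (\<^bold>\<exists>s\<^bold>\<in>elements D. is_sup D S s)))"

definition way_below :: "('a, 'o::complete_heyting) hstruct \<Rightarrow> 'a \<Rightarrow> 'a \<Rightarrow> 'o"  (infix "\<lless>\<index>" 50)
  where "way_below D x y =
    (\<^bold>\<forall>S\<^bold>\<subseteq>D. directed D S \<^bold>\<longrightarrow>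
       (\<^bold>\<forall>s\<^bold>\<in>elements D. (is_sup D S s \<^bold>\<and> hle D y s) \<^bold>\<longrightarrow> (\<^bold>\<exists>z\<^bold>\<in>S. hle D x z)))"

definition basis :: "('a, 'o::complete_heyting) hstruct \<Rightarrow> ('a \<Rightarrow> 'o) \<Rightarrow> 'o"
  where "basis D B =
    (\<^bold>\<forall>x\<^bold>\<in>elements D.
       directed D \<^bold>{b\<^bold>\<in>B. way_below D b x\<^bold>} \<^bold>\<and> is_sup D \<^bold>{b\<^bold>\<in>B. way_below D b x\<^bold>} x)"

definition up_way :: "('a, 'o::complete_heyting) hstruct \<Rightarrow> 'a \<Rightarrow> 'a \<Rightarrow> 'o"
  where "up_way D b = \<^bold>{y\<^bold>\<in>elements D. way_below D b y\<^bold>}"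

definition scott_open :: "('a, 'o::complete_heyting) hstruct \<Rightarrow> ('a \<Rightarrow> 'o) \<Rightarrow> 'o"
  where "scott_open D U =
    ((\<^bold>\<forall>x\<^bold>\<in>U. \<^bold>\<forall>y\<^bold>\<in>elements D. hle D x y \<^bold>\<longrightarrow> U y) \<^bold>\<and>
     (\<^bold>\<forall>S\<^bold>\<subseteq>D. directed D S \<^bold>\<longrightarrow>
        (\<^bold>\<forall>s\<^bold>\<in>elements D. (is_sup D S s \<^bold>\<and> U s) \<^bold>\<longrightarrow> (\<^bold>\<exists>x\<^bold>\<in>S. U x))))"

definition not_scott_le :: "('a, 'o::complete_heyting) hstruct \<Rightarrow> 'a \<Rightarrow> 'a \<Rightarrow> 'o"
  where "not_scott_le D x y = (\<^bold>\<exists>U\<^bold>\<subseteq>D. scott_open D U \<^bold>\<and> U x \<^bold>\<and> \<^bold>\<not> U y)"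

definition intrinsic_apart :: "('a, 'o::complete_heyting) hstruct \<Rightarrow> 'a \<Rightarrow> 'a \<Rightarrow> 'o"
  where "intrinsic_apart D x y = (not_scott_le D x y \<^bold>\<or> not_scott_le D y x)"


section \<open>Topology and apartness\<close>

text \<open>
  In this section the order of the structure \<open>X\<close> plays no role. A topology is given by the
  predicate \<open>T\<close> of being open, and \<open>R\<close> is the relation written as an apartness.
\<close>

definition interior ::
    "('a, 'o::complete_heyting) hstruct \<Rightarrow> (('a \<Rightarrow> 'o) \<Rightarrow> 'o) \<Rightarrow> ('a \<Rightarrow> 'o) \<Rightarrow> 'a \<Rightarrow> 'o"
  where "interior X T Y = \<^bold>{x\<^bold>\<in>elements X. \<^bold>\<exists>U\<^bold>\<subseteq>X. T U \<^bold>\<and> U x \<^bold>\<and> U \<^bold>\<subseteq> Y\<^bold>}"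

definition logical_complement ::
    "('a, 'o::complete_heyting) hstruct \<Rightarrow> ('a \<Rightarrow> 'o) \<Rightarrow> 'a \<Rightarrow> 'o"
  where "logical_complement X A = \<^bold>{x\<^bold>\<in>elements X. \<^bold>\<not> A x\<^bold>}"

definition complement ::
    "('a, 'o::complete_heyting) hstruct \<Rightarrow> ('a \<Rightarrow> 'a \<Rightarrow> 'o) \<Rightarrow> ('a \<Rightarrow> 'o) \<Rightarrow> 'a \<Rightarrow> 'o"
  where "complement X R A = \<^bold>{x\<^bold>\<in>elements X. \<^bold>\<forall>y\<^bold>\<in>A. R x y\<^bold>}"

definition apartness_complement ::
    "('a, 'o::complete_heyting) hstruct \<Rightarrow> (('a \<Rightarrow> 'o) \<Rightarrow> 'o) \<Rightarrow> ('a \<Rightarrow> 'a \<Rightarrow> 'o) \<Rightarrow>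
      ('a \<Rightarrow> 'o) \<Rightarrow> 'a \<Rightarrow> 'o"
  where "apartness_complement X T R A = \<^bold>{x\<^bold>\<in>elements X. interior X T (complement X R A) x\<^bold>}"

definition nearly_open ::
    "('a, 'o::complete_heyting) hstruct \<Rightarrow> (('a \<Rightarrow> 'o) \<Rightarrow> 'o) \<Rightarrow> ('a \<Rightarrow> 'a \<Rightarrow> 'o) \<Rightarrow>
      ('a \<Rightarrow> 'o) \<Rightarrow> 'o"
  where "nearly_open X T R U = (\<^bold>\<exists>A\<^bold>\<subseteq>X. U \<^bold>= apartness_complement X T R A)"

text \<open>
  The open sets of the apartness topology are the unions of nearly open sets. Constructively
  they need not be nearly open themselves: in the one-point dcpo every subset is Scott open and
  is a union of nearly open sets, whereas a nearly open set is a logical complement,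
  so if all open sets were nearly open, excluded middle would follow. The equivalence of Scott
  open and nearly open is therefore asserted for sets \<open>U\<close> with \<open>U = (\<not>\<not>U)\<degree>\<close> only, a condition which
  for \<open>'o = bool\<close> holds for every Scott open set.
\<close>

definition apartness_open ::
    "('a, 'o::complete_heyting) hstruct \<Rightarrow> (('a \<Rightarrow> 'o) \<Rightarrow> 'o) \<Rightarrow> ('a \<Rightarrow> 'a \<Rightarrow> 'o) \<Rightarrow>
      ('a \<Rightarrow> 'o) \<Rightarrow> 'o"
  where "apartness_open X T R U =
    (\<^bold>\<forall>x\<^bold>\<in>U. \<^bold>\<exists>V\<^bold>\<subseteq>X. nearly_open X T R V \<^bold>\<and> V x \<^bold>\<and> V \<^bold>\<subseteq> U)"

definition topology_basis ::
    "('a, 'o::complete_heyting) hstruct \<Rightarrow> (('a \<Rightarrow> 'o) \<Rightarrow> 'o) \<Rightarrow> (('a \<Rightarrow> 'o) \<Rightarrow> 'o) \<Rightarrow> 'o"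
  where "topology_basis X T F =
    ((\<^bold>\<forall>U\<^bold>\<subseteq>X. F U \<^bold>\<longrightarrow> T U) \<^bold>\<and>
     (\<^bold>\<forall>U\<^bold>\<subseteq>X. T U \<^bold>\<longrightarrow> (\<^bold>\<forall>x\<^bold>\<in>U. \<^bold>\<exists>V\<^bold>\<subseteq>X. F V \<^bold>\<and> V x \<^bold>\<and> V \<^bold>\<subseteq> U)))"

definition nn_stable ::
    "('a, 'o::complete_heyting) hstruct \<Rightarrow> (('a \<Rightarrow> 'o) \<Rightarrow> 'o) \<Rightarrow> ('a \<Rightarrow> 'o) \<Rightarrow> 'o"
  where "nn_stable X T U =
    (U \<^bold>= interior X T (logical_complement X (logical_complement X U)))"

definition nn_stable_basis ::
    "('a, 'o::complete_heyting) hstruct \<Rightarrow> (('a \<Rightarrow> 'o) \<Rightarrow> 'o) \<Rightarrow> (('a \<Rightarrow> 'o) \<Rightarrow> 'o) \<Rightarrow> 'o"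
  where "nn_stable_basis X T F = (topology_basis X T F \<^bold>\<and> (\<^bold>\<forall>U\<^bold>\<subseteq>X. F U \<^bold>\<longrightarrow> nn_stable X T U))"

end

theory Submission
  imports Defs
begin

text \<open>
  Truth is tested in the style of Kripke and Joyal: \<open>p \<le> \<phi>\<close> is read as: \<open>\<phi>\<close> holds at stage \<open>p\<close>,
  so that intuitionistic natural deduction becomes a set of rules about \<open>\<le>\<close>.

  For the theorem, let \<open>x\<close> be an interior point of \<open>\<not>\<not>\<Up>b\<close>, where \<open>\<Up>b\<close> is the set of points
  which \<open>b\<close> is way below. Approximating \<open>x\<close> inside an open
  set \<open>W \<subseteq> \<not>\<not>\<Up>b\<close> gives \<open>c \<in> B\<close> with \<open>c \<lless> x\<close> and \<open>\<not>\<not>(b \<lless> c)\<close>, hence \<open>\<not>\<not>(b \<sqsubseteq> c)\<close>; each of the four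
  conditions removes one of the double negations and yields \<open>b \<lless> x\<close>. A \<open>\<not>\<not>\<close>-stable open set \<open>U\<close> is
  the apartness complement of \<open>\<not>U\<close>: the set \<open>U\<close> itself witnesses that its points are apart from those
  of \<open>\<not>U\<close>, and since the apartness is irreflexive every subset of \<open>\<sim>\<not>U\<close> is contained in \<open>\<not>\<not>U\<close>.
\<close>

section \<open>Forcing rules\<close>

lemma hmp: "p \<le> (a \<^bold>\<longrightarrow> b) \<Longrightarrow> p \<le> a \<Longrightarrow> p \<le> b"
  by (metis le_himp_iff inf.absorb1)

text \<open>Among the stages below \<open>p\<close> that force \<open>a\<close> the largest is
  \<open>inf p a\<close>, so quantifying over all of them amounts to the residuation law
  \<open>le_himp_iff\<close>.\<close>

lemma himpI: "(\<And>q. q \<le> p \<Longrightarrow> q \<le> a \<Longrightarrow> q \<le> b) \<Longrightarrow> p \<le> (a \<^bold>\<longrightarrow> b)"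
  by (simp add: le_himp_iff)

lemma hnotI: "(\<And>q. q \<le> p \<Longrightarrow> q \<le> a \<Longrightarrow> q \<le> bot) \<Longrightarrow> p \<le> (\<^bold>\<not> a)"
  unfolding hnot_def by (rule himpI)

lemma hnotE: "p \<le> (\<^bold>\<not> a) \<Longrightarrow> p \<le> a \<Longrightarrow> p \<le> c"
  unfolding hnot_def using hmp bot_least order_trans by blast

text \<open>Distributivity cuts the stage \<open>p\<close> into pieces \<open>inf p a\<close>, each
  forcing one member of \<open>A\<close>. No piece need be all of \<open>p\<close>, so nothing is
  chosen. The eliminations of disjunction and of both existential quantifiers are instances.\<close>

lemma inf_Sup_least:
  fixes p :: "'o::complete_heyting"
  assumes "p \<le> Sup A" "\<And>a q. a \<in> A \<Longrightarrow> q \<le> p \<Longrightarrow> q \<le> a \<Longrightarrow> q \<le> c"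
  shows "p \<le> c"
proof -
  have "p \<le> inf p (Sup A)" using assms(1) by simp
  also have "\<dots> \<le> (SUP a\<in>A. inf p a)" by (rule inf_Sup_le_SUP_inf)
  also have "\<dots> \<le> c" by (auto intro!: SUP_least assms(2))
  finally show ?thesis .
qed

lemma horE:
  fixes p :: "'o::complete_heyting"
  assumes "p \<le> (a \<^bold>\<or> b)"
    and "\<And>q. q \<le> p \<Longrightarrow> q \<le> a \<Longrightarrow> q \<le> c" "\<And>q. q \<le> p \<Longrightarrow> q \<le> b \<Longrightarrow> q \<le> c"
  shows "p \<le> c"
  by (rule inf_Sup_least[of p "{a, b}"]) (use assms in auto)

lemma hballI: "(\<And>x q. q \<le> p \<Longrightarrow> q \<le> S x \<Longrightarrow> q \<le> P x) \<Longrightarrow> p \<le> hball S P"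
  unfolding hball_def by (intro INF_greatest himpI) auto

lemma hballD: "p \<le> hball S P \<Longrightarrow> p \<le> S x \<Longrightarrow> p \<le> P x"
  unfolding hball_def by (meson INF_lower UNIV_I hmp order_trans)

lemma hbexI: "p \<le> S x \<Longrightarrow> p \<le> P x \<Longrightarrow> p \<le> hbex S P"
  unfolding hbex_def by (rule SUP_upper2[of x]) auto

lemma hbexE:
  assumes "p \<le> hbex S P" "\<And>x q. q \<le> p \<Longrightarrow> q \<le> S x \<Longrightarrow> q \<le> P x \<Longrightarrow> q \<le> c"
  shows "p \<le> c"
  by (rule inf_Sup_least[OF assms(1)[unfolded hbex_def]]) (use assms(2) in auto)

lemma hball_subI: "(\<And>S. S \<in> subsets D \<Longrightarrow> p \<le> P S) \<Longrightarrow> p \<le> hball_sub D P"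
  unfolding hball_sub_def by (rule INF_greatest)

lemma hball_subD: "p \<le> hball_sub D P \<Longrightarrow> S \<in> subsets D \<Longrightarrow> p \<le> P S"
  unfolding hball_sub_def by (meson INF_lower order_trans)

lemma hbex_subI: "S \<in> subsets D \<Longrightarrow> p \<le> P S \<Longrightarrow> p \<le> hbex_sub D P"
  unfolding hbex_sub_def by (rule SUP_upper2)

lemma hbex_subE:
  assumes "p \<le> hbex_sub D P" "\<And>S q. S \<in> subsets D \<Longrightarrow> q \<le> p \<Longrightarrow> q \<le> P S \<Longrightarrow> q \<le> c"
  shows "p \<le> c"
  by (rule inf_Sup_least[OF assms(1)[unfolded hbex_sub_def]]) (use assms(2) in auto)

lemma le_hcollect_iff: "p \<le> hcollect S P x \<longleftrightarrow> p \<le> S x \<and> p \<le> P x"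
  by (simp add: hcollect_def)

lemma hsubsetI: "(\<And>x q. q \<le> p \<Longrightarrow> q \<le> S x \<Longrightarrow> q \<le> T x) \<Longrightarrow> p \<le> (S \<^bold>\<subseteq> T)"
  unfolding hsubset_def by (rule hballI)

lemma hsubsetD: "p \<le> (S \<^bold>\<subseteq> T) \<Longrightarrow> p \<le> S x \<Longrightarrow> p \<le> T x"
  unfolding hsubset_def by (rule hballD[of p S T])

lemma le_hseteq_iff: "p \<le> (S \<^bold>= T) \<longleftrightarrow> p \<le> (S \<^bold>\<subseteq> T) \<and> p \<le> (T \<^bold>\<subseteq> S)"
  by (simp add: hseteq_def)

lemma decidable_stable: "p \<le> decidable a \<Longrightarrow> p \<le> (\<^bold>\<not> \<^bold>\<not> a) \<Longrightarrow> p \<le> a"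
  unfolding decidable_def by (erule horE) (auto intro: hnotE order_trans)

text \<open>Contraposition applied twice, with the implication from \<open>a\<close> to
  \<open>b\<close> required only at stages below \<open>p\<close>.\<close>

lemma hnot_hnot_mono:
  assumes "p \<le> (\<^bold>\<not> \<^bold>\<not> a)" "\<And>q. q \<le> p \<Longrightarrow> q \<le> a \<Longrightarrow> q \<le> b"
  shows "p \<le> (\<^bold>\<not> \<^bold>\<not> b)"
proof (rule hnotI)
  fix q assume q: "q \<le> p" "q \<le> (\<^bold>\<not> b)"
  have "q \<le> (\<^bold>\<not> a)"
    by (rule hnotI) (meson q assms(2) hnotE order_trans)
  then show "q \<le> bot" using q assms(1) hnotE order_trans by blast
qed


section \<open>Directed sets, suprema and Scott open sets at a stage\<close>

lemma directedI:
  assumes "p \<le> (\<^bold>\<exists>x\<^bold>\<in>S. top)"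
    and "\<And>x y q. q \<le> p \<Longrightarrow> q \<le> S x \<Longrightarrow> q \<le> S y \<Longrightarrow> q \<le> (\<^bold>\<exists>z\<^bold>\<in>S. hle D x z \<^bold>\<and> hle D y z)"
  shows "p \<le> directed D S"
  unfolding directed_def using assms(1)
  by (auto intro!: hballI intro: assms(2) order_trans)

lemma directed_inhabited: "p \<le> directed D S \<Longrightarrow> p \<le> (\<^bold>\<exists>x\<^bold>\<in>S. top)"
  by (simp add: directed_def)

lemma directed_upper:
  "p \<le> directed D S \<Longrightarrow> p \<le> S x \<Longrightarrow> p \<le> S y \<Longrightarrow> p \<le> (\<^bold>\<exists>z\<^bold>\<in>S. hle D x z \<^bold>\<and> hle D y z)"
  unfolding directed_def le_inf_iff by (blast dest: hballD)

lemma is_supI: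
  assumes "\<And>x q. q \<le> p \<Longrightarrow> q \<le> S x \<Longrightarrow> q \<le> hle D x s"
    and "\<And>u q. q \<le> p \<Longrightarrow> q \<le> elements D u \<Longrightarrow> q \<le> (\<^bold>\<forall>x\<^bold>\<in>S. hle D x u) \<Longrightarrow> q \<le> hle D s u"
  shows "p \<le> is_sup D S s"
  unfolding is_sup_def by (auto intro!: hballI himpI intro: assms order_trans)

lemma is_sup_upper: "p \<le> is_sup D S s \<Longrightarrow> p \<le> S x \<Longrightarrow> p \<le> hle D x s"
  unfolding is_sup_def le_inf_iff by (blast dest: hballD)

lemma is_sup_least:
  "p \<le> is_sup D S s \<Longrightarrow> p \<le> elements D u \<Longrightarrow> p \<le> (\<^bold>\<forall>x\<^bold>\<in>S. hle D x u) \<Longrightarrow> p \<le> hle D s u"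
  unfolding is_sup_def le_inf_iff by (blast dest: hballD hmp)

lemma way_belowI:
  assumes "\<And>S s q. S \<in> subsets D \<Longrightarrow> q \<le> p \<Longrightarrow> q \<le> directed D S \<Longrightarrow> q \<le> elements D s \<Longrightarrow>
      q \<le> is_sup D S s \<Longrightarrow> q \<le> hle D y s \<Longrightarrow> q \<le> (\<^bold>\<exists>z\<^bold>\<in>S. hle D x z)"
  shows "p \<le> way_below D x y"
  unfolding way_below_def
  by (intro hball_subI himpI hballI, unfold le_inf_iff) (meson assms order_trans)

lemma way_belowD:
  "p \<le> way_below D x y \<Longrightarrow> S \<in> subsets D \<Longrightarrow> p \<le> directed D S \<Longrightarrow> p \<le> elements D s \<Longrightarrow>
    p \<le> is_sup D S s \<Longrightarrow> p \<le> hle D y s \<Longrightarrow> p \<le> (\<^bold>\<exists>z\<^bold>\<in>S. hle D x z)"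
  unfolding way_below_def by (drule (1) hball_subD, drule (1) hmp, drule (1) hballD, erule hmp) simp

lemma scott_openI:
  assumes "\<And>x y q. q \<le> p \<Longrightarrow> q \<le> U x \<Longrightarrow> q \<le> elements D y \<Longrightarrow> q \<le> hle D x y \<Longrightarrow> q \<le> U y"
    and "\<And>S s q. S \<in> subsets D \<Longrightarrow> q \<le> p \<Longrightarrow> q \<le> directed D S \<Longrightarrow> q \<le> elements D s \<Longrightarrow>
      q \<le> is_sup D S s \<Longrightarrow> q \<le> U s \<Longrightarrow> q \<le> (\<^bold>\<exists>x\<^bold>\<in>S. U x)"
  shows "p \<le> scott_open D U"
  unfolding scott_open_def le_inf_iff
proof (intro conjI hball_subI himpI hballI, goal_cases)
  case 1
  then show ?case by (meson assms(1) order_trans)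
next
  case 2
  then show ?case unfolding le_inf_iff by (meson assms(2) order_trans)
qed

lemma scott_open_upper:
  "p \<le> scott_open D U \<Longrightarrow> p \<le> U x \<Longrightarrow> p \<le> elements D y \<Longrightarrow> p \<le> hle D x y \<Longrightarrow> p \<le> U y"
  unfolding scott_open_def le_inf_iff by (blast dest: hballD hmp)

lemma scott_open_sup:
  "p \<le> scott_open D U \<Longrightarrow> S \<in> subsets D \<Longrightarrow> p \<le> directed D S \<Longrightarrow> p \<le> elements D s \<Longrightarrow>
    p \<le> is_sup D S s \<Longrightarrow> p \<le> U s \<Longrightarrow> p \<le> (\<^bold>\<exists>x\<^bold>\<in>S. U x)"
  unfolding scott_open_def le_inf_iff
  by (drule conjunct2, drule (1) hball_subD, drule (1) hmp, drule (1) hballD, erule hmp) simp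

lemma subsets_elements: "S \<in> subsets D \<Longrightarrow> p \<le> S x \<Longrightarrow> p \<le> elements D x"
  unfolding subsets_def using order_trans by blast

lemma subsets_heq: "S \<in> subsets D \<Longrightarrow> p \<le> S x \<Longrightarrow> p \<le> heq D x y \<Longrightarrow> p \<le> S y"
  unfolding subsets_def by (auto intro: order_trans[of p "inf (S x) (heq D x y)"])

text \<open>The generic stages \<open>S x\<close> and \<open>inf (S x) (heq D x y)\<close> turn the
  two rules into the inequalities that define \<open>subsets\<close>.\<close>

lemma subsetsI:
  assumes "\<And>x p. p \<le> S x \<Longrightarrow> p \<le> elements D x"
    and "\<And>x y p. p \<le> S x \<Longrightarrow> p \<le> heq D x y \<Longrightarrow> p \<le> S y"
  shows "S \<in> subsets D"
  unfolding subsets_def using assms(1)[OF order_refl] assms(2)[OF inf_le1 inf_le2] by blast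

text \<open>Constructive form of the fact that unions of Scott open sets are Scott open: either
  closure property of \<open>U\<close> at a point is inherited from an open neighbourhood
  \<open>W\<close> inside \<open>U\<close>. All later transfers of openness go through this
  criterion.\<close>

lemma scott_open_if_local:
  assumes "U \<in> subsets D"
    and local: "\<And>x q. q \<le> p \<Longrightarrow> q \<le> U x \<Longrightarrow>
      q \<le> (\<^bold>\<exists>W\<^bold>\<subseteq>D. scott_open D W \<^bold>\<and> W x \<^bold>\<and> W \<^bold>\<subseteq> U)"
  shows "p \<le> scott_open D U"
proof (rule scott_openI)
  fix x y q assume q: "q \<le> p" "q \<le> U x" "q \<le> elements D y" "q \<le> hle D x y"
  show "q \<le> U y"
  proof (rule hbex_subE[OF local[OF q(1,2)]])
    fix W r assume r: "W \<in> subsets D" "r \<le> q"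
      "r \<le> (scott_open D W \<^bold>\<and> W x \<^bold>\<and> W \<^bold>\<subseteq> U)"
    then have "r \<le> W y"
      using scott_open_upper[of r D W x y] order_trans[OF r(2) q(3)] order_trans[OF r(2) q(4)] by simp
    then show "r \<le> U y" using r(3) hsubsetD[of r W U y] by simp
  qed
next
  fix S s q assume q: "S \<in> subsets D" "q \<le> p" "q \<le> directed D S" "q \<le> elements D s"
      "q \<le> is_sup D S s" "q \<le> U s"
  show "q \<le> (\<^bold>\<exists>x\<^bold>\<in>S. U x)"
  proof (rule hbex_subE[OF local[OF q(2,6)]])
    fix W r assume r: "W \<in> subsets D" "r \<le> q"
      "r \<le> (scott_open D W \<^bold>\<and> W s \<^bold>\<and> W \<^bold>\<subseteq> U)"
    have "r \<le> (\<^bold>\<exists>x\<^bold>\<in>S. W x)"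
      by (rule scott_open_sup[of _ D _ _ s]) (use r q in \<open>auto intro: order_trans\<close>)
    then show "r \<le> (\<^bold>\<exists>x\<^bold>\<in>S. U x)"
    proof (rule hbexE)
      fix x t assume "t \<le> r" "t \<le> S x" "t \<le> W x"
      then show "t \<le> (\<^bold>\<exists>x\<^bold>\<in>S. U x)"
        using r(3) by (auto intro!: hbexI[of _ _ x] intro: hsubsetD[of t W] order_trans)
    qed
  qed
qed

text \<open>The sets agree only at stage \<open>p\<close>, so \<open>V\<close> cannot be rewritten
  to \<open>U\<close>. Instead \<open>U\<close> serves as the open neighbourhood of every point of
  \<open>V\<close>.\<close>

lemma scott_open_hseteq:
  assumes "U \<in> subsets D" "V \<in> subsets D" "p \<le> scott_open D U" "p \<le> (V \<^bold>= U)"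
  shows "p \<le> scott_open D V"
proof (rule scott_open_if_local[OF assms(2)])
  fix x q assume q: "q \<le> p" "q \<le> V x"
  have eq: "q \<le> (V \<^bold>\<subseteq> U)" "q \<le> (U \<^bold>\<subseteq> V)"
    using order_trans[OF q(1) assms(4)] by (simp_all add: le_hseteq_iff)
  show "q \<le> (\<^bold>\<exists>W\<^bold>\<subseteq>D. scott_open D W \<^bold>\<and> W x \<^bold>\<and> W \<^bold>\<subseteq> V)"
    by (rule hbex_subI[OF assms(1)])
      (use eq q hsubsetD[OF eq(1) q(2)] order_trans[OF q(1) assms(3)] in simp)
qed

section \<open>Interiors and double complements\<close>

lemma interiorI:
  "p \<le> elements X x \<Longrightarrow> U \<in> subsets X \<Longrightarrow> p \<le> T U \<Longrightarrow> p \<le> U x \<Longrightarrow> p \<le> (U \<^bold>\<subseteq> Y) \<Longrightarrow>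
    p \<le> interior X T Y x"
  unfolding interior_def le_hcollect_iff by (auto intro: hbex_subI)

lemma interiorE:
  assumes "p \<le> interior X T Y x"
    and "\<And>U q. U \<in> subsets X \<Longrightarrow> q \<le> p \<Longrightarrow> q \<le> T U \<Longrightarrow> q \<le> U x \<Longrightarrow> q \<le> (U \<^bold>\<subseteq> Y) \<Longrightarrow> q \<le> c"
  shows "p \<le> c"
  using assms(1) unfolding interior_def le_hcollect_iff
  by (auto elim!: hbex_subE intro: assms(2))

lemma interior_elements: "p \<le> interior X T Y x \<Longrightarrow> p \<le> elements X x"
  by (simp add: interior_def le_hcollect_iff)

lemma le_logical_complement_iff:
  "p \<le> logical_complement X A x \<longleftrightarrow> p \<le> elements X x \<and> p \<le> (\<^bold>\<not> A x)"
  by (simp add: logical_complement_def le_hcollect_iff)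

text \<open>Each complement carries its own membership conjunct. The inner one is already forced
  once \<open>x\<close> is an element at stage \<open>p\<close>, so only the double negation of
  \<open>A x\<close> remains.\<close>

lemma le_double_complement_iff:
  "p \<le> logical_complement X (logical_complement X A) x \<longleftrightarrow> p \<le> elements X x \<and> p \<le> (\<^bold>\<not> \<^bold>\<not> A x)"
  (is "?L \<longleftrightarrow> ?R")
proof
  assume L: ?L
  have "p \<le> (\<^bold>\<not> \<^bold>\<not> A x)"
  proof (rule hnotI)
    fix q assume "q \<le> p" "q \<le> (\<^bold>\<not> A x)"
    with L show "q \<le> bot"
      unfolding le_logical_complement_iff
      by (meson hnotE le_logical_complement_iff order_trans)
  qed
  with L show ?R by (simp add: le_logical_complement_iff)
next
  assume R: ?R
  have "p \<le> (\<^bold>\<not> logical_complement X A x)"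
    by (rule hnotI) (meson R hnotE le_logical_complement_iff order_trans)
  with R show ?L by (simp add: le_logical_complement_iff)
qed

text \<open>The half of stability that every open set has: \<open>U\<close> is its own neighbourhood
  inside its double complement.\<close>

lemma open_subset_interior_double_complement:
  assumes "U \<in> subsets X" "p \<le> T U"
  shows "p \<le> (U \<^bold>\<subseteq> interior X T (logical_complement X (logical_complement X U)))"
proof (rule hsubsetI)
  fix x q assume q: "q \<le> p" "q \<le> U x"
  have "q \<le> (U \<^bold>\<subseteq> logical_complement X (logical_complement X U))"
    by (rule hsubsetI)
      (auto simp: le_double_complement_iff intro: subsets_elements[OF assms(1)] hnotI hnotE order_trans)
  then show "q \<le> interior X T (logical_complement X (logical_complement X U)) x"
    using interiorI[OF _ assms(1)] subsets_elements[OF assms(1) q(2)] q order_trans[OF q(1) assms(2)]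
    by blast
qed


section \<open>Heyting-valued sets with an order\<close>

locale heyting_set =
  fixes D :: "('a, 'o::complete_heyting) hstruct" (structure)
  assumes hstructure: "hstructure D"
begin

lemma heq_sym: "p \<le> (x \<approx> y) \<Longrightarrow> p \<le> (y \<approx> x)"
  using hstructure unfolding hstructure_def by (meson order_trans)

text \<open>Going from \<open>x\<close> to \<open>y\<close> and back by symmetry and transitivity
  gives the self-equality that expresses membership.\<close>

lemma heq_elements: "p \<le> (x \<approx> y) \<Longrightarrow> p \<le> elements D x \<and> p \<le> elements D y"
  using hstructure heq_sym[of p x y] unfolding hstructure_def elements_def
  by (meson le_infI order_trans)

lemma hle_elements: "p \<le> (x \<sqsubseteq> y) \<Longrightarrow> p \<le> elements D x \<and> p \<le> elements D y"
  using hstructure unfolding hstructure_def by (meson le_inf_iff order_trans)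

lemma hle_heq: "p \<le> (x \<sqsubseteq> y) \<Longrightarrow> p \<le> (x \<approx> x') \<Longrightarrow> p \<le> (y \<approx> y') \<Longrightarrow> p \<le> (x' \<sqsubseteq> y')"
  using hstructure unfolding hstructure_def by (meson le_infI order_trans)

lemma way_below_heq_left:
  assumes "p \<le> (x \<lless> y)" "p \<le> (x \<approx> x')"
  shows "p \<le> (x' \<lless> y)"
proof (rule way_belowI)
  fix S s q assume q: "S \<in> subsets D" "q \<le> p" "q \<le> directed D S" "q \<le> elements D s"
      "q \<le> is_sup D S s" "q \<le> (y \<sqsubseteq> s)"
  show "q \<le> (\<^bold>\<exists>z\<^bold>\<in>S. x' \<sqsubseteq> z)"
  proof (rule hbexE[OF way_belowD[OF order_trans[OF q(2) assms(1)] q(1,3-6)]])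
    fix z r assume r: "r \<le> q" "r \<le> S z" "r \<le> (x \<sqsubseteq> z)"
    \<comment> \<open>The required equality of \<open>z\<close> with itself is the membership of
      \<open>z\<close> in \<open>D\<close>, supplied by \<open>S\<close>.\<close>
    then have "r \<le> (x' \<sqsubseteq> z)"
      using hle_heq[of r x z x' z] assms(2) q(2) subsets_elements[OF q(1) r(2)]
      unfolding elements_def by (meson order_trans)
    with r show "r \<le> (\<^bold>\<exists>z\<^bold>\<in>S. x' \<sqsubseteq> z)" by (intro hbexI)
  qed
qed

lemma way_below_heq_right:
  assumes "p \<le> (x \<lless> y)" "p \<le> (y \<approx> y')"
  shows "p \<le> (x \<lless> y')"
proof (rule way_belowI)
  fix S s q assume q: "S \<in> subsets D" "q \<le> p" "q \<le> directed D S" "q \<le> elements D s"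
      "q \<le> is_sup D S s" "q \<le> (y' \<sqsubseteq> s)"
  have "q \<le> (y \<sqsubseteq> s)"
    using hle_heq[OF q(6) heq_sym] q(2,4) assms(2) unfolding elements_def by (meson order_trans)
  then show "q \<le> (\<^bold>\<exists>z\<^bold>\<in>S. x \<sqsubseteq> z)"
    using way_belowD[OF order_trans[OF q(2) assms(1)] q(1,3-5)] by blast
qed

lemma up_way_subsets: "up_way D b \<in> subsets D"
  unfolding up_way_def
  by (rule subsetsI) (auto simp: le_hcollect_iff dest: heq_elements intro: way_below_heq_right)

lemma logical_complement_subsets:
  assumes "A \<in> subsets D"
  shows "logical_complement D A \<in> subsets D"
proof (rule subsetsI)
  fix x y p assume p: "p \<le> logical_complement D A x" "p \<le> (x \<approx> y)"
  have "p \<le> (\<^bold>\<not> A y)"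
  proof (rule hnotI)
    fix q assume q: "q \<le> p" "q \<le> A y"
    have "q \<le> A x"
      using subsets_heq[OF assms q(2) heq_sym[OF order_trans[OF q(1) p(2)]]] .
    with p(1) q(1) show "q \<le> bot"
      unfolding le_logical_complement_iff by (meson hnotE order_trans)
  qed
  with p show "p \<le> logical_complement D A y"
    using heq_elements by (simp add: le_logical_complement_iff)
qed (simp add: le_logical_complement_iff)

section \<open>Apartness and nearly open sets\<close>

lemma intrinsic_apart_irrefl: "p \<le> intrinsic_apart D x x \<Longrightarrow> p \<le> bot"
  \<comment> \<open>Either disjunct yields an open set that both contains \<open>x\<close> and
    excludes \<open>x\<close>.\<close>
  unfolding intrinsic_apart_def not_scott_le_def
  by (auto elim!: horE hbex_subE intro: hnotE)

text \<open>An apartness complement is an interior, and a neighbourhood \<open>W\<close> that puts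
  one point into an interior puts all of its points there. This gives openness for an arbitrary
  relation \<open>R\<close>.\<close>

lemma nearly_open_local:
  assumes "p \<le> nearly_open D (scott_open D) R V" "p \<le> V x"
  shows "p \<le> (\<^bold>\<exists>W\<^bold>\<subseteq>D. scott_open D W \<^bold>\<and> W x \<^bold>\<and> W \<^bold>\<subseteq> V)"
proof (rule hbex_subE[OF assms(1)[unfolded nearly_open_def]])
  fix A q assume q: "q \<le> p" "q \<le> (V \<^bold>= apartness_complement D (scott_open D) R A)"
  have "q \<le> apartness_complement D (scott_open D) R A x"
    using q(2) order_trans[OF q(1) assms(2)] by (auto simp: le_hseteq_iff intro: hsubsetD)
  then have "q \<le> interior D (scott_open D) (complement D R A) x"
    by (simp add: apartness_complement_def le_hcollect_iff)
  then show "q \<le> (\<^bold>\<exists>W\<^bold>\<subseteq>D. scott_open D W \<^bold>\<and> W x \<^bold>\<and> W \<^bold>\<subseteq> V)"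
  proof (rule interiorE)
    fix W r assume r: "W \<in> subsets D" "r \<le> q" "r \<le> scott_open D W" "r \<le> W x"
      "r \<le> (W \<^bold>\<subseteq> complement D R A)"
    have "r \<le> (W \<^bold>\<subseteq> V)"
    proof (rule hsubsetI)
      fix y t assume t: "t \<le> r" "t \<le> W y"
      have "t \<le> elements D y" using subsets_elements[OF r(1) t(2)] .
      \<comment> \<open>The neighbourhood \<open>W\<close> of \<open>x\<close> is reused as a
        neighbourhood of \<open>y\<close>.\<close>
      moreover have "t \<le> interior D (scott_open D) (complement D R A) y"
        by (rule interiorI[OF calculation r(1) _ t(2)]) (use r t in \<open>auto intro: order_trans\<close>)
      ultimately have "t \<le> apartness_complement D (scott_open D) R A y"
        by (simp add: apartness_complement_def le_hcollect_iff)
      moreover have "t \<le> (apartness_complement D (scott_open D) R A \<^bold>\<subseteq> V)"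
        using q(2) r(2) t(1) unfolding le_hseteq_iff by (meson order_trans)
      ultimately show "t \<le> V y" by (rule hsubsetD[rotated])
    qed
    with r show "r \<le> (\<^bold>\<exists>W\<^bold>\<subseteq>D. scott_open D W \<^bold>\<and> W x \<^bold>\<and> W \<^bold>\<subseteq> V)"
      by (intro hbex_subI[of W]) auto
  qed
qed

lemma nearly_open_imp_scott_open:
  assumes "V \<in> subsets D" "p \<le> nearly_open D (scott_open D) R V"
  shows "p \<le> scott_open D V"
  using scott_open_if_local[OF assms(1)] nearly_open_local order_trans[OF _ assms(2)] by blast

lemma apartness_open_imp_scott_open:
  assumes "U \<in> subsets D" "p \<le> apartness_open D (scott_open D) R U"
  shows "p \<le> scott_open D U"
proof (rule scott_open_if_local[OF assms(1)])
  fix x q assume q: "q \<le> p" "q \<le> U x"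
  have "q \<le> (\<^bold>\<exists>V\<^bold>\<subseteq>D. nearly_open D (scott_open D) R V \<^bold>\<and> V x \<^bold>\<and> V \<^bold>\<subseteq> U)"
    using order_trans[OF q(1) assms(2)] q(2) unfolding apartness_open_def by (rule hballD)
  then show "q \<le> (\<^bold>\<exists>W\<^bold>\<subseteq>D. scott_open D W \<^bold>\<and> W x \<^bold>\<and> W \<^bold>\<subseteq> U)"
  proof (rule hbex_subE)
    fix V r assume "V \<in> subsets D" "r \<le> (nearly_open D (scott_open D) R V \<^bold>\<and> V x \<^bold>\<and> V \<^bold>\<subseteq> U)"
    then show "r \<le> (\<^bold>\<exists>W\<^bold>\<subseteq>D. scott_open D W \<^bold>\<and> W x \<^bold>\<and> W \<^bold>\<subseteq> U)"
      by (intro hbex_subI[of V]) (auto intro: nearly_open_imp_scott_open)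
  qed
qed

text \<open>With \<open>A\<close> the logical complement of \<open>U\<close>, the apartness
  complement of \<open>A\<close> is squeezed between the open set \<open>U\<close> and the interior
  of the double complement of \<open>U\<close>. Stability identifies the two ends.\<close>

lemma nn_stable_open_imp_nearly_open:
  assumes "U \<in> subsets D" "p \<le> scott_open D U" "p \<le> nn_stable D (scott_open D) U"
  shows "p \<le> nearly_open D (scott_open D) (intrinsic_apart D) U"
  unfolding nearly_open_def
proof (rule hbex_subI[OF logical_complement_subsets[OF assms(1)]])
  let ?C = "complement D (intrinsic_apart D) (logical_complement D U)"
  have U_C: "p \<le> (U \<^bold>\<subseteq> ?C)"
  proof (rule hsubsetI)
    fix x q assume q: "q \<le> p" "q \<le> U x"
    have "q \<le> (\<^bold>\<forall>y\<^bold>\<in>logical_complement D U. intrinsic_apart D x y)"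
    proof (rule hballI)
      fix y r assume "r \<le> q" "r \<le> logical_complement D U y"
      then have "r \<le> not_scott_le D x y"
        unfolding not_scott_le_def using q assms(2)
        by (intro hbex_subI[OF assms(1)]) (auto simp: le_logical_complement_iff intro: order_trans)
      then show "r \<le> intrinsic_apart D x y"
        by (simp add: intrinsic_apart_def le_supI1)
    qed
    then show "q \<le> ?C x"
      using subsets_elements[OF assms(1) q(2)] by (simp add: complement_def le_hcollect_iff)
  qed
  \<comment> \<open>Being proved at \<open>top\<close>, this inclusion is available at every later
    stage.\<close>
  have C_nn: "top \<le> (?C \<^bold>\<subseteq> logical_complement D (logical_complement D U))"
  proof (rule hsubsetI)
    fix x q assume "q \<le> ?C x"
    then have q: "q \<le> elements D x" "q \<le> (\<^bold>\<forall>y\<^bold>\<in>logical_complement D U. intrinsic_apart D x y)"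
      by (simp_all add: complement_def le_hcollect_iff)
    have "q \<le> (\<^bold>\<not> logical_complement D U x)"
      by (rule hnotI) (meson q(2) hballD intrinsic_apart_irrefl order_trans)
    with q(1) show "q \<le> logical_complement D (logical_complement D U) x"
      by (simp add: le_logical_complement_iff)
  qed
  show "p \<le> (U \<^bold>= apartness_complement D (scott_open D) (intrinsic_apart D) (logical_complement D U))"
    unfolding le_hseteq_iff
  proof (intro conjI hsubsetI)
    fix x q assume q: "q \<le> p" "q \<le> U x"
    have "q \<le> interior D (scott_open D) ?C x"
      by (rule interiorI[OF subsets_elements[OF assms(1) q(2)] assms(1) _ q(2)])
        (use q(1) assms(2) U_C in \<open>auto intro: order_trans\<close>)
    then show "q \<le> apartness_complement D (scott_open D) (intrinsic_apart D) (logical_complement D U) x"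
      using interior_elements by (auto simp: apartness_complement_def le_hcollect_iff)
  next
    fix x q assume q: "q \<le> p"
      "q \<le> apartness_complement D (scott_open D) (intrinsic_apart D) (logical_complement D U) x"
    then have "q \<le> interior D (scott_open D) ?C x"
      by (simp add: apartness_complement_def le_hcollect_iff)
    then have "q \<le> interior D (scott_open D) (logical_complement D (logical_complement D U)) x"
    proof (rule interiorE)
      fix W r assume r: "W \<in> subsets D" "r \<le> scott_open D W" "r \<le> W x" "r \<le> (W \<^bold>\<subseteq> ?C)"
      have "r \<le> (W \<^bold>\<subseteq> logical_complement D (logical_complement D U))"
        by (rule hsubsetI) (meson r(4) C_nn hsubsetD order_trans top_greatest)
      then show "r \<le> interior D (scott_open D) (logical_complement D (logical_complement D U)) x"
        using interiorI[OF subsets_elements[OF r(1,3)] r(1)] r by blast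
    qed
    then show "q \<le> U x"
      using order_trans[OF q(1) assms(3)]
      by (auto simp: nn_stable_def le_hseteq_iff intro: hsubsetD)
  qed
qed

end


section \<open>Continuous dcpos\<close>

text \<open>The dcpo and basis axioms are assumed at a stage \<open>w\<close> rather than outright,
  so that the locale can be interpreted at any stage forcing the premises of an internal
  implication.\<close>

locale based_at_stage = heyting_set D
  for D :: "('a, 'o::complete_heyting) hstruct" (structure) +
  fixes B :: "'a \<Rightarrow> 'o" and w :: 'o
  assumes B_subsets: "B \<in> subsets D"
    and dcpo: "w \<le> dcpo D"
    and basis: "w \<le> basis D B"
begin

lemma hle_refl:
  assumes "p \<le> w" "p \<le> elements D x"
  shows "p \<le> (x \<sqsubseteq> x)"
  using order_trans[OF assms(1) dcpo] assms(2) unfolding dcpo_def poset_def le_inf_iff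
  by (blast dest: hballD)

lemma hle_trans:
  assumes "p \<le> w" "p \<le> (x \<sqsubseteq> y)" "p \<le> (y \<sqsubseteq> z)"
  shows "p \<le> (x \<sqsubseteq> z)"
proof -
  have "p \<le> (\<^bold>\<forall>x\<^bold>\<in>elements D. \<^bold>\<forall>y\<^bold>\<in>elements D. \<^bold>\<forall>z\<^bold>\<in>elements D.
        (x \<sqsubseteq> y \<^bold>\<and> y \<sqsubseteq> z) \<^bold>\<longrightarrow> x \<sqsubseteq> z)"
    using order_trans[OF assms(1) dcpo] unfolding dcpo_def poset_def le_inf_iff by blast
  then have "p \<le> ((x \<sqsubseteq> y \<^bold>\<and> y \<sqsubseteq> z) \<^bold>\<longrightarrow> x \<sqsubseteq> z)"
    using hle_elements[OF assms(2)] hle_elements[OF assms(3)] by (blast dest: hballD)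
  then show ?thesis using assms by (auto intro: hmp)
qed

abbreviation approx :: "'a \<Rightarrow> 'a \<Rightarrow> 'o"
  where "approx x \<equiv> \<^bold>{b\<^bold>\<in>B. b \<lless> x\<^bold>}"

lemma approx_subsets: "approx x \<in> subsets D"
  by (rule subsetsI)
    (auto simp: le_hcollect_iff intro: subsets_elements[OF B_subsets] subsets_heq[OF B_subsets]
      way_below_heq_left)

lemma
  assumes "p \<le> w" "p \<le> elements D x"
  shows directed_approx: "p \<le> directed D (approx x)"
    and is_sup_approx: "p \<le> is_sup D (approx x) x"
  using hballD[OF order_trans[OF assms(1) basis, unfolded basis_def] assms(2)] by auto

text \<open>The way-below relation is tested on the directed set \<open>approx y\<close>, whose
  supremum is \<open>y\<close>: the member found above \<open>x\<close> is itself below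
  \<open>y\<close>.\<close>

lemma way_below_imp_hle:
  assumes "p \<le> w" "p \<le> elements D y" "p \<le> (x \<lless> y)"
  shows "p \<le> (x \<sqsubseteq> y)"
proof (rule hbexE[OF way_belowD[OF assms(3) approx_subsets directed_approx[OF assms(1,2)] assms(2)
      is_sup_approx[OF assms(1,2)] hle_refl[OF assms(1,2)]]])
  fix z q assume q: "q \<le> p" "q \<le> approx y z" "q \<le> (x \<sqsubseteq> z)"
  have qw: "q \<le> w" "q \<le> elements D y" using q(1) assms(1,2) order_trans by blast+
  show "q \<le> (x \<sqsubseteq> y)"
    by (rule hle_trans[OF qw(1) q(3) is_sup_upper[OF is_sup_approx[OF qw] q(2)]])
qed

lemma hle_way_below:
  assumes "p \<le> w" "p \<le> (x' \<sqsubseteq> x)" "p \<le> (x \<lless> y)"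
  shows "p \<le> (x' \<lless> y)"
proof (rule way_belowI)
  fix S s q assume q: "S \<in> subsets D" "q \<le> p" "q \<le> directed D S" "q \<le> elements D s"
      "q \<le> is_sup D S s" "q \<le> (y \<sqsubseteq> s)"
  show "q \<le> (\<^bold>\<exists>z\<^bold>\<in>S. x' \<sqsubseteq> z)"
  proof (rule hbexE[OF way_belowD[OF order_trans[OF q(2) assms(3)] q(1,3-6)]])
    fix z r assume r: "r \<le> q" "r \<le> S z" "r \<le> (x \<sqsubseteq> z)"
    then have "r \<le> (x' \<sqsubseteq> z)"
      by (meson hle_trans assms(1,2) q(2) order_trans)
    with r show "r \<le> (\<^bold>\<exists>z\<^bold>\<in>S. x' \<sqsubseteq> z)" by (intro hbexI)
  qed
qed

lemma way_below_hle:
  assumes "p \<le> w" "p \<le> (x \<lless> y)" "p \<le> (y \<sqsubseteq> y')"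
  shows "p \<le> (x \<lless> y')"
proof (rule way_belowI)
  fix S s q assume q: "S \<in> subsets D" "q \<le> p" "q \<le> directed D S" "q \<le> elements D s"
      "q \<le> is_sup D S s" "q \<le> (y' \<sqsubseteq> s)"
  have "q \<le> (y \<sqsubseteq> s)" by (meson hle_trans assms(1,3) q(2,6) order_trans)
  then show "q \<le> (\<^bold>\<exists>z\<^bold>\<in>S. x \<sqsubseteq> z)"
    using way_belowD[OF order_trans[OF q(2) assms(2)] q(1,3-5)] by blast
qed

lemma way_below_trans:
  assumes "p \<le> w" "p \<le> elements D z" "p \<le> (x \<lless> y)" "p \<le> (y \<lless> z)"
  shows "p \<le> (x \<lless> z)"
  using way_below_hle[OF assms(1,3) way_below_imp_hle[OF assms(1,2,4)]] .

section \<open>Interpolation for the way-below relation\<close>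

abbreviation approx2 :: "'a \<Rightarrow> 'a \<Rightarrow> 'o"
  where "approx2 y \<equiv> \<^bold>{c\<^bold>\<in>B. \<^bold>\<exists>b\<^bold>\<in>B. c \<lless> b \<^bold>\<and> b \<lless> y\<^bold>}"

lemma approx2I: "p \<le> B c \<Longrightarrow> p \<le> B b \<Longrightarrow> p \<le> (c \<lless> b) \<Longrightarrow> p \<le> (b \<lless> y) \<Longrightarrow> p \<le> approx2 y c"
  by (auto simp: le_hcollect_iff intro: hbexI[of _ _ b])

lemma approx2E:
  assumes "p \<le> approx2 y c"
    and "\<And>b q. q \<le> p \<Longrightarrow> q \<le> B c \<Longrightarrow> q \<le> B b \<Longrightarrow> q \<le> (c \<lless> b) \<Longrightarrow> q \<le> (b \<lless> y) \<Longrightarrow> q \<le> r"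
  shows "p \<le> r"
proof -
  have p: "p \<le> B c" "p \<le> (\<^bold>\<exists>b\<^bold>\<in>B. c \<lless> b \<^bold>\<and> b \<lless> y)"
    using assms(1) by (simp_all add: le_hcollect_iff)
  show ?thesis
    by (rule hbexE[OF p(2)]) (simp add: assms(2) order_trans[OF _ p(1)])
qed

lemma approx2_subsets: "approx2 y \<in> subsets D"
proof (rule subsetsI)
  fix x p assume "p \<le> approx2 y x"
  then show "p \<le> elements D x"
    by (auto simp: le_hcollect_iff intro: subsets_elements[OF B_subsets])
next
  fix c c' p assume p: "p \<le> approx2 y c" "p \<le> (c \<approx> c')"
  from p(1) show "p \<le> approx2 y c'"
  proof (rule approx2E)
    fix b q assume q: "q \<le> p" "q \<le> B c" "q \<le> B b" "q \<le> (c \<lless> b)" "q \<le> (b \<lless> y)"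
    note eq = order_trans[OF q(1) p(2)]
    show "q \<le> approx2 y c'"
      by (rule approx2I[OF subsets_heq[OF B_subsets q(2) eq] q(3) way_below_heq_left[OF q(4) eq] q(5)])
  qed
qed

text \<open>Directedness is used at two levels. Intermediate elements \<open>b1\<close> and
  \<open>b2\<close> have an upper bound \<open>b\<close> in \<open>approx y\<close>; then
  \<open>c1\<close> and \<open>c2\<close> both lie in \<open>approx b\<close>, which supplies the
  upper bound \<open>c\<close>, with \<open>b\<close> as its intermediate element.\<close>

lemma directed_approx2:
  assumes "p \<le> w" "p \<le> elements D y"
  shows "p \<le> directed D (approx2 y)"
proof (rule directedI)
  show "p \<le> (\<^bold>\<exists>c\<^bold>\<in>approx2 y. top)"
  proof (rule hbexE[OF directed_inhabited[OF directed_approx[OF assms]]])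
    fix b q assume q: "q \<le> p" "q \<le> approx y b"
    then have b: "q \<le> w" "q \<le> B b" "q \<le> (b \<lless> y)"
      using assms order_trans by (auto simp: le_hcollect_iff)
    note b_el = subsets_elements[OF B_subsets b(2)]
    show "q \<le> (\<^bold>\<exists>c\<^bold>\<in>approx2 y. top)"
    proof (rule hbexE[OF directed_inhabited[OF directed_approx[OF b(1) b_el]]])
      fix c r assume "r \<le> q" "r \<le> approx b c"
      then have "r \<le> approx2 y c"
        using b order_trans by (intro approx2I[of _ c b]) (auto simp: le_hcollect_iff)
      then show "r \<le> (\<^bold>\<exists>c\<^bold>\<in>approx2 y. top)" by (rule hbexI) simp
    qed
  qed
next
  fix c1 c2 q assume q: "q \<le> p" "q \<le> approx2 y c1" "q \<le> approx2 y c2"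
  let ?goal = "\<^bold>\<exists>z\<^bold>\<in>approx2 y. c1 \<sqsubseteq> z \<^bold>\<and> c2 \<sqsubseteq> z"
  from q(2) show "q \<le> ?goal"
  proof (rule approx2E)
    fix b1 q' assume 1: "q' \<le> q" "q' \<le> B c1" "q' \<le> B b1" "q' \<le> (c1 \<lless> b1)" "q' \<le> (b1 \<lless> y)"
    from order_trans[OF 1(1) q(3)] show "q' \<le> ?goal"
    proof (rule approx2E)
      fix b2 r assume 2: "r \<le> q'" "r \<le> B c2" "r \<le> B b2" "r \<le> (c2 \<lless> b2)" "r \<le> (b2 \<lless> y)"
      have rw: "r \<le> w" "r \<le> elements D y" by (meson 1(1) 2(1) q(1) assms order_trans)+
      have "r \<le> approx y b1" "r \<le> approx y b2"
        using 1 2 order_trans by (auto simp: le_hcollect_iff)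
      from directed_upper[OF directed_approx[OF rw] this] show "r \<le> ?goal"
      proof (rule hbexE)
        fix b s assume s: "s \<le> r" "s \<le> approx y b" "s \<le> (b1 \<sqsubseteq> b \<^bold>\<and> b2 \<sqsubseteq> b)"
        have b: "s \<le> B b" "s \<le> (b \<lless> y)" using s(2) by (simp_all add: le_hcollect_iff)
        have sw: "s \<le> w" using order_trans[OF s(1) rw(1)] .
        have "s \<le> (c1 \<lless> b1)" "s \<le> (c2 \<lless> b2)" "s \<le> B c1" "s \<le> B c2"
          by (meson 1(2,4) 2(1,2,4) s(1) order_trans)+
        then have "s \<le> approx b c1" "s \<le> approx b c2"
          using s(3) by (auto simp: le_hcollect_iff intro: way_below_hle[OF sw])
        from directed_upper[OF directed_approx[OF sw subsets_elements[OF B_subsets b(1)]] this]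
        show "s \<le> ?goal"
        proof (rule hbexE)
          fix c t assume t: "t \<le> s" "t \<le> approx b c" "t \<le> (c1 \<sqsubseteq> c \<^bold>\<and> c2 \<sqsubseteq> c)"
          have "t \<le> approx2 y c"
            by (rule approx2I[of _ c b]) (use t b order_trans in \<open>auto simp: le_hcollect_iff\<close>)
          then show "t \<le> ?goal" using t(3) by (rule hbexI)
        qed
      qed
    qed
  qed
qed

text \<open>An iterated supremum: an upper bound of \<open>approx2 y\<close> bounds
  \<open>approx b\<close> for each \<open>b\<close> in \<open>approx y\<close>, hence bounds
  \<open>b\<close>, hence bounds \<open>y\<close>.\<close>

lemma is_sup_approx2:
  assumes "p \<le> w" "p \<le> elements D y"
  shows "p \<le> is_sup D (approx2 y) y"
proof (rule is_supI)
  fix c q assume q: "q \<le> p" "q \<le> approx2 y c"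
  from q(2) show "q \<le> (c \<sqsubseteq> y)"
  proof (rule approx2E)
    fix b r assume r: "r \<le> q" "r \<le> (c \<lless> b)" "r \<le> (b \<lless> y)"
    have "r \<le> w" "r \<le> elements D y" by (meson q(1) r(1) assms order_trans)+
    with r show "r \<le> (c \<sqsubseteq> y)" by (meson way_below_trans way_below_imp_hle)
  qed
next
  fix u q assume q: "q \<le> p" "q \<le> elements D u" "q \<le> (\<^bold>\<forall>c\<^bold>\<in>approx2 y. c \<sqsubseteq> u)"
  have qw: "q \<le> w" "q \<le> elements D y" by (meson q(1) assms order_trans)+
  have "q \<le> (\<^bold>\<forall>b\<^bold>\<in>approx y. b \<sqsubseteq> u)"
  proof (rule hballI)
    fix b r assume r: "r \<le> q" "r \<le> approx y b"
    have b: "r \<le> B b" "r \<le> (b \<lless> y)" using r(2) by (simp_all add: le_hcollect_iff)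
    have rw: "r \<le> w" "r \<le> elements D u" by (meson r(1) qw(1) q(2) order_trans)+
    show "r \<le> (b \<sqsubseteq> u)"
    proof (rule is_sup_least[OF is_sup_approx[OF rw(1) subsets_elements[OF B_subsets b(1)]] rw(2)])
      show "r \<le> (\<^bold>\<forall>c\<^bold>\<in>approx b. c \<sqsubseteq> u)"
      proof (rule hballI)
        fix c t assume t: "t \<le> r" "t \<le> approx b c"
        have "t \<le> approx2 y c"
          by (rule approx2I[of _ c b]) (use t b order_trans in \<open>auto simp: le_hcollect_iff\<close>)
        then show "t \<le> (c \<sqsubseteq> u)" by (rule hballD[OF order_trans[OF order_trans[OF t(1) r(1)] q(3)]])
      qed
    qed
  qed
  then show "q \<le> (y \<sqsubseteq> u)" by (rule is_sup_least[OF is_sup_approx[OF qw] q(2)])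
qed

text \<open>Testing \<open>x \<lless> y\<close> on \<open>approx2 y\<close> gives a \<open>c\<close>
  above \<open>x\<close> together with its intermediate element \<open>b\<close>, and this
  \<open>b\<close> interpolates.\<close>

lemma way_below_interpolation:
  assumes "p \<le> w" "p \<le> elements D y" "p \<le> (x \<lless> y)"
  shows "p \<le> (\<^bold>\<exists>b\<^bold>\<in>B. x \<lless> b \<^bold>\<and> b \<lless> y)"
proof (rule hbexE[OF way_belowD[OF assms(3) approx2_subsets directed_approx2[OF assms(1,2)] assms(2)
      is_sup_approx2[OF assms(1,2)] hle_refl[OF assms(1,2)]]])
  fix c q assume q: "q \<le> p" "q \<le> approx2 y c" "q \<le> (x \<sqsubseteq> c)"
  from q(2) show "q \<le> (\<^bold>\<exists>b\<^bold>\<in>B. x \<lless> b \<^bold>\<and> b \<lless> y)"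
  proof (rule approx2E)
    fix b r assume r: "r \<le> q" "r \<le> B b" "r \<le> (c \<lless> b)" "r \<le> (b \<lless> y)"
    have "r \<le> (x \<lless> b)" by (meson hle_way_below q(1,3) r(1,3) assms(1) order_trans)
    with r show "r \<le> (\<^bold>\<exists>b\<^bold>\<in>B. x \<lless> b \<^bold>\<and> b \<lless> y)" by (intro hbexI[of _ _ b]) auto
  qed
qed

section \<open>Basic Scott open sets\<close>

lemma le_up_way_iff: "p \<le> up_way D b x \<longleftrightarrow> p \<le> elements D x \<and> p \<le> (b \<lless> x)"
  by (simp add: up_way_def le_hcollect_iff)

text \<open>From \<open>b \<lless> s\<close> alone a directed set with supremum \<open>s\<close>
  yields only an element above \<open>b\<close>. An interpolant \<open>c\<close> restores the strict
  relation: an element above \<open>c\<close> has \<open>b\<close> way below it.\<close>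

lemma scott_open_up_way:
  assumes "p \<le> w"
  shows "p \<le> scott_open D (up_way D b)"
proof (rule scott_openI)
  fix x y q assume "q \<le> p" "q \<le> up_way D b x" "q \<le> elements D y" "q \<le> (x \<sqsubseteq> y)"
  then show "q \<le> up_way D b y"
    using assms unfolding le_up_way_iff by (meson way_below_hle order_trans)
next
  fix S s q assume q: "S \<in> subsets D" "q \<le> p" "q \<le> directed D S" "q \<le> elements D s"
      "q \<le> is_sup D S s" "q \<le> up_way D b s"
  have qw: "q \<le> w" using order_trans[OF q(2) assms] .
  have "q \<le> (b \<lless> s)" using q(6) by (simp add: le_up_way_iff)
  from way_below_interpolation[OF qw q(4) this] show "q \<le> (\<^bold>\<exists>x\<^bold>\<in>S. up_way D b x)"
  proof (rule hbexE)
    fix c r assume r: "r \<le> q" "r \<le> B c" "r \<le> (b \<lless> c \<^bold>\<and> c \<lless> s)"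
    have rw: "r \<le> w" "r \<le> elements D s" by (meson r(1) qw q(4) order_trans)+
    \<comment> \<open>The relation \<open>c \<lless> s\<close> is tested on \<open>S\<close> itself,
      with reflexivity giving \<open>s\<close> below the supremum.\<close>
    have "r \<le> (\<^bold>\<exists>z\<^bold>\<in>S. c \<sqsubseteq> z)"
      by (rule way_belowD[OF _ q(1) _ rw(2)])
        (use r q rw in \<open>auto intro: order_trans hle_refl\<close>)
    then show "r \<le> (\<^bold>\<exists>x\<^bold>\<in>S. up_way D b x)"
    proof (rule hbexE)
      fix z t assume t: "t \<le> r" "t \<le> S z" "t \<le> (c \<sqsubseteq> z)"
      have "t \<le> (b \<lless> z)" using r(3) t rw(1) unfolding le_inf_iff by (meson way_below_hle order_trans)
      with t(2) show "t \<le> (\<^bold>\<exists>x\<^bold>\<in>S. up_way D b x)"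
        using subsets_elements[OF q(1) t(2)] by (intro hbexI[of _ _ z]) (auto simp: le_up_way_iff)
    qed
  qed
qed

text \<open>Since \<open>x\<close> is the directed supremum of \<open>approx x\<close>, an open set
  containing \<open>x\<close> must meet \<open>approx x\<close>.\<close>

lemma scott_open_approx:
  assumes "p \<le> w" "U \<in> subsets D" "p \<le> scott_open D U" "p \<le> U x"
  shows "p \<le> (\<^bold>\<exists>b\<^bold>\<in>approx x. U b)"
  using scott_open_sup[OF assms(3) approx_subsets directed_approx _ is_sup_approx assms(4)]
    assms(1) subsets_elements[OF assms(2,4)] by blast

lemma up_way_subset_scott_open:
  assumes "p \<le> w" "p \<le> scott_open D U" "p \<le> U b"
  shows "p \<le> (up_way D b \<^bold>\<subseteq> U)"
proof (rule hsubsetI)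
  fix y q assume q: "q \<le> p" "q \<le> up_way D b y"
  have "q \<le> (b \<sqsubseteq> y)"
    using q(2) way_below_imp_hle order_trans[OF q(1) assms(1)] by (simp add: le_up_way_iff)
  then show "q \<le> U y"
    using scott_open_upper[of q D U b y] hle_elements q(1) assms(2,3) by (meson order_trans)
qed

text \<open>The family of basic sets is itself a truth-valued predicate, so membership in it is
  internal equality with some \<open>up_way D b\<close>. Openness therefore passes through
  \<open>scott_open_hseteq\<close>, and neighbourhoods come from
  \<open>scott_open_approx\<close>.\<close>

lemma topology_basis_up_way:
  "w \<le> topology_basis D (scott_open D) (\<lambda>U. \<^bold>\<exists>b\<^bold>\<in>B. U \<^bold>= up_way D b)"
  unfolding topology_basis_def le_inf_iff
proof (intro conjI hball_subI himpI hballI)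
  fix U q assume U: "U \<in> subsets D" and q: "q \<le> w" "q \<le> (\<^bold>\<exists>b\<^bold>\<in>B. U \<^bold>= up_way D b)"
  from q(2) show "q \<le> scott_open D U"
    by (rule hbexE)
      (meson scott_open_hseteq up_way_subsets U scott_open_up_way q(1) order_trans)
next
  fix U q x r assume U: "U \<in> subsets D" and q: "q \<le> w" "q \<le> scott_open D U" "r \<le> q" "r \<le> U x"
  have r: "r \<le> w" "r \<le> scott_open D U" by (meson q order_trans)+
  from scott_open_approx[OF r(1) U r(2) q(4)]
  show "r \<le> (\<^bold>\<exists>V\<^bold>\<subseteq>D. (\<^bold>\<exists>b\<^bold>\<in>B. V \<^bold>= up_way D b) \<^bold>\<and> V x \<^bold>\<and> V \<^bold>\<subseteq> U)"
  proof (rule hbexE)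
    fix b t assume t: "t \<le> r" "t \<le> approx x b" "t \<le> U b"
    have b: "t \<le> B b" "t \<le> (b \<lless> x)" using t(2) by (simp_all add: le_hcollect_iff)
    have "t \<le> up_way D b x"
      using b(2) subsets_elements[OF U order_trans[OF t(1) q(4)]] by (simp add: le_up_way_iff)
    \<comment> \<open>The index \<open>b\<close> itself witnesses membership in the family.\<close>
    moreover have "t \<le> (\<^bold>\<exists>b'\<^bold>\<in>B. up_way D b \<^bold>= up_way D b')"
      using b(1) by (rule hbexI) (auto simp: le_hseteq_iff intro: hsubsetI)
    moreover have "t \<le> (up_way D b \<^bold>\<subseteq> U)"
      using up_way_subset_scott_open t(3) r t(1) by (meson order_trans)
    ultimately show "t \<le> (\<^bold>\<exists>V\<^bold>\<subseteq>D. (\<^bold>\<exists>b\<^bold>\<in>B. V \<^bold>= up_way D b) \<^bold>\<and> V x \<^bold>\<and> V \<^bold>\<subseteq> U)"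
      by (intro hbex_subI[OF up_way_subsets[of b]]) auto
  qed
qed

end

section \<open>Stability under any of the four conditions\<close>

locale stable_based_at_stage = based_at_stage +
  assumes stable: "w \<le>
      ((\<^bold>\<forall>a\<^bold>\<in>B. \<^bold>\<forall>b\<^bold>\<in>B. \<^bold>\<not> \<^bold>\<not> (a \<lless> b) \<^bold>\<longrightarrow> a \<lless> b) \<^bold>\<or>
       (\<^bold>\<forall>a\<^bold>\<in>B. \<^bold>\<forall>b\<^bold>\<in>B. \<^bold>\<not> \<^bold>\<not> (a \<sqsubseteq> b) \<^bold>\<longrightarrow> a \<sqsubseteq> b) \<^bold>\<or>
       (\<^bold>\<forall>a\<^bold>\<in>B. \<^bold>\<forall>b\<^bold>\<in>B. decidable (a \<lless> b)) \<^bold>\<or>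
       (\<^bold>\<forall>a\<^bold>\<in>B. \<^bold>\<forall>b\<^bold>\<in>B. decidable (a \<sqsubseteq> b)))"
begin

text \<open>The only place where the four alternatives are separated. Conditions on
  \<open>\<lless>\<close> recover \<open>a \<lless> b\<close>, which composes with
  \<open>b \<lless> x\<close>; conditions on \<open>\<sqsubseteq>\<close> recover
  \<open>a \<sqsubseteq> b\<close>, which suffices for the same conclusion. Different alternatives
  may hold at different later stages, so the split happens inside the proof.\<close>

lemma not_not_way_below_trans:
  assumes "p \<le> w" "p \<le> B a" "p \<le> B b" "p \<le> elements D x" "p \<le> (\<^bold>\<not> \<^bold>\<not> (a \<lless> b))" "p \<le> (b \<lless> x)"
  shows "p \<le> (a \<lless> x)"
proof -
  have nle: "p \<le> (\<^bold>\<not> \<^bold>\<not> (a \<sqsubseteq> b))"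
    using assms(5)
  proof (rule hnot_hnot_mono)
    fix q assume "q \<le> p" "q \<le> (a \<lless> b)"
    then show "q \<le> (a \<sqsubseteq> b)"
      using way_below_imp_hle subsets_elements[OF B_subsets] assms(1,3) by (meson order_trans)
  qed
  have le: "q \<le> (a \<lless> x)" if "q \<le> p" "q \<le> (a \<sqsubseteq> b)" for q
    using that hle_way_below assms(1,6) by (meson order_trans)
  have wb: "q \<le> (a \<lless> x)" if "q \<le> p" "q \<le> (a \<lless> b)" for q
    using that way_below_trans assms(1,4,6) by (meson order_trans)
  have at: "q \<le> P a b" if "q \<le> p" "q \<le> (\<^bold>\<forall>a\<^bold>\<in>B. \<^bold>\<forall>b\<^bold>\<in>B. P a b)" for q P
    by (rule hballD[OF hballD[OF that(2)]]) (use that(1) assms(2,3) order_trans in blast)+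
  from order_trans[OF assms(1) stable] show ?thesis
  proof (elim horE)
    fix q assume q: "q \<le> p" "q \<le> (\<^bold>\<forall>a\<^bold>\<in>B. \<^bold>\<forall>b\<^bold>\<in>B. \<^bold>\<not> \<^bold>\<not> (a \<lless> b) \<^bold>\<longrightarrow> a \<lless> b)"
    show "q \<le> (a \<lless> x)"
      by (rule wb[OF q(1) hmp[OF at[OF q] order_trans[OF q(1) assms(5)]]])
  next
    \<comment> \<open>Each split of the right-nested disjunction moves to a later stage, hence the
      chain of stages in this case and the next two.\<close>
    fix q q' assume "q' \<le> p" "q \<le> q'"
      and q: "q \<le> (\<^bold>\<forall>a\<^bold>\<in>B. \<^bold>\<forall>b\<^bold>\<in>B. \<^bold>\<not> \<^bold>\<not> (a \<sqsubseteq> b) \<^bold>\<longrightarrow> a \<sqsubseteq> b)"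
    then have qp: "q \<le> p" by order
    show "q \<le> (a \<lless> x)"
      by (rule le[OF qp hmp[OF at[OF qp q] order_trans[OF qp nle]]])
  next
    fix q q' q'' assume "q' \<le> p" "q'' \<le> q'" "q \<le> q''"
      and q: "q \<le> (\<^bold>\<forall>a\<^bold>\<in>B. \<^bold>\<forall>b\<^bold>\<in>B. decidable (a \<lless> b))"
    then have qp: "q \<le> p" by order
    show "q \<le> (a \<lless> x)"
      by (rule wb[OF qp decidable_stable[OF at[OF qp q] order_trans[OF qp assms(5)]]])
  next
    fix q q' q'' assume "q' \<le> p" "q'' \<le> q'" "q \<le> q''"
      and q: "q \<le> (\<^bold>\<forall>a\<^bold>\<in>B. \<^bold>\<forall>b\<^bold>\<in>B. decidable (a \<sqsubseteq> b))"
    then have qp: "q \<le> p" by order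
    show "q \<le> (a \<lless> x)"
      by (rule le[OF qp decidable_stable[OF at[OF qp q] order_trans[OF qp nle]]])
  qed
qed

text \<open>Stated for a set \<open>U\<close> that equals \<open>up_way D b\<close> at stage
  \<open>p\<close>, because this is all that membership in the family of basic sets
  provides.\<close>

lemma nn_stable_up_way:
  assumes "U \<in> subsets D" "p \<le> w" "p \<le> B b" "p \<le> (U \<^bold>= up_way D b)"
  shows "p \<le> nn_stable D (scott_open D) U"
  unfolding nn_stable_def le_hseteq_iff
proof
  have "p \<le> scott_open D U"
    by (rule scott_open_hseteq[OF up_way_subsets assms(1) scott_open_up_way[OF assms(2)] assms(4)])
  then show "p \<le> (U \<^bold>\<subseteq> interior D (scott_open D) (logical_complement D (logical_complement D U)))"
    by (rule open_subset_interior_double_complement[OF assms(1)])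
  show "p \<le> (interior D (scott_open D) (logical_complement D (logical_complement D U)) \<^bold>\<subseteq> U)"
  proof (rule hsubsetI)
    fix x q assume q: "q \<le> p"
      "q \<le> interior D (scott_open D) (logical_complement D (logical_complement D U)) x"
    from q(2) show "q \<le> U x"
    proof (rule interiorE)
      fix W r assume r: "W \<in> subsets D" "r \<le> q" "r \<le> scott_open D W" "r \<le> W x"
        "r \<le> (W \<^bold>\<subseteq> logical_complement D (logical_complement D U))"
      have rw: "r \<le> w" by (meson r(2) q(1) assms(2) order_trans)
      from scott_open_approx[OF rw r(1,3,4)] show "r \<le> U x"
      proof (rule hbexE)
        fix c t assume t: "t \<le> r" "t \<le> approx x c" "t \<le> W c"
        have c: "t \<le> B c" "t \<le> (c \<lless> x)" using t(2) by (simp_all add: le_hcollect_iff)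
        have tp: "t \<le> p" by (meson t(1) r(2) q(1) order_trans)
        have eq: "t \<le> (U \<^bold>\<subseteq> up_way D b)" "t \<le> (up_way D b \<^bold>\<subseteq> U)"
          using order_trans[OF tp assms(4)] by (simp_all add: le_hseteq_iff)
        have x: "t \<le> elements D x" using subsets_elements[OF r(1) order_trans[OF t(1) r(4)]] .
        have "t \<le> (\<^bold>\<not> \<^bold>\<not> U c)"
          using hsubsetD[OF order_trans[OF t(1) r(5)] t(3)] by (simp add: le_double_complement_iff)
        then have "t \<le> (\<^bold>\<not> \<^bold>\<not> (b \<lless> c))"
        proof (rule hnot_hnot_mono)
          fix s assume "s \<le> t" "s \<le> U c"
          then have "s \<le> up_way D b c" using hsubsetD[OF order_trans[OF _ eq(1)]] by simp
          then show "s \<le> (b \<lless> c)" by (simp add: le_up_way_iff)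
        qed
        \<comment> \<open>Both \<open>b\<close> and \<open>c\<close> lie in the basis, so the double
          negation can be removed here.\<close>
        then have "t \<le> (b \<lless> x)"
          using not_not_way_below_trans[OF _ _ c(1) x _ c(2)] tp assms(2,3) by (meson order_trans)
        then show "t \<le> U x"
          using x by (intro hsubsetD[OF eq(2)]) (simp add: le_up_way_iff)
      qed
    qed
  qed
qed

lemma nn_stable_basis_up_way:
  "w \<le> nn_stable_basis D (scott_open D) (\<lambda>U. \<^bold>\<exists>b\<^bold>\<in>B. U \<^bold>= up_way D b)"
  unfolding nn_stable_basis_def le_inf_iff
proof (intro conjI topology_basis_up_way hball_subI himpI)
  fix U q assume "U \<in> subsets D" "q \<le> w" "q \<le> (\<^bold>\<exists>b\<^bold>\<in>B. U \<^bold>= up_way D b)"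
  then show "q \<le> nn_stable D (scott_open D) U"
    by (elim hbexE) (meson nn_stable_up_way order_trans)
qed

text \<open>Each point of \<open>U\<close> has a basic neighbourhood inside \<open>U\<close>, and
  basic sets are open and stable, hence nearly open. Stability is thus asked of the basic sets and
  not of \<open>U\<close>.\<close>

lemma scott_open_imp_apartness_open:
  assumes "U \<in> subsets D" "p \<le> w" "p \<le> scott_open D U"
  shows "p \<le> apartness_open D (scott_open D) (intrinsic_apart D) U"
  unfolding apartness_open_def
proof (rule hballI)
  fix x q assume q: "q \<le> p" "q \<le> U x"
  have qw: "q \<le> w" using order_trans[OF q(1) assms(2)] .
  have "q \<le> (\<^bold>\<forall>U\<^bold>\<subseteq>D. scott_open D U \<^bold>\<longrightarrow> (\<^bold>\<forall>x\<^bold>\<in>U. \<^bold>\<exists>V\<^bold>\<subseteq>D.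
      (\<^bold>\<exists>b\<^bold>\<in>B. V \<^bold>= up_way D b) \<^bold>\<and> V x \<^bold>\<and> V \<^bold>\<subseteq> U))"
    using order_trans[OF qw topology_basis_up_way] by (simp add: topology_basis_def)
  from hballD[OF hmp[OF hball_subD[OF this assms(1)] order_trans[OF q(1) assms(3)]] q(2)]
  show "q \<le> (\<^bold>\<exists>V\<^bold>\<subseteq>D. nearly_open D (scott_open D) (intrinsic_apart D) V \<^bold>\<and> V x \<^bold>\<and> V \<^bold>\<subseteq> U)"
  proof (rule hbex_subE)
    fix V r assume V: "V \<in> subsets D" and r: "r \<le> q"
      "r \<le> ((\<^bold>\<exists>b\<^bold>\<in>B. V \<^bold>= up_way D b) \<^bold>\<and> V x \<^bold>\<and> V \<^bold>\<subseteq> U)"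
    have rw: "r \<le> w" using order_trans[OF r(1) qw] .
    have "r \<le> (\<^bold>\<exists>b\<^bold>\<in>B. V \<^bold>= up_way D b)" using r(2) by simp
    then have "r \<le> nearly_open D (scott_open D) (intrinsic_apart D) V"
    proof (rule hbexE)
      fix b t assume t: "t \<le> r" "t \<le> B b" "t \<le> (V \<^bold>= up_way D b)"
      have tw: "t \<le> w" using order_trans[OF t(1) rw] .
      show "t \<le> nearly_open D (scott_open D) (intrinsic_apart D) V"
        by (rule nn_stable_open_imp_nearly_open[OF V
            scott_open_hseteq[OF up_way_subsets V scott_open_up_way[OF tw] t(3)]
            nn_stable_up_way[OF V tw t(2,3)]])
    qed
    with r show "r \<le> (\<^bold>\<exists>V\<^bold>\<subseteq>D. nearly_open D (scott_open D) (intrinsic_apart D) V \<^bold>\<and> V x \<^bold>\<and> V \<^bold>\<subseteq> U)"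
      by (intro hbex_subI[OF V]) auto
  qed
qed

end

text \<open>The two external assumptions only say what kind of data \<open>D\<close> and
  \<open>B\<close> are. All mathematical hypotheses are truth values, so the theorem is a single
  implication with value \<open>top\<close>.\<close>

theorem theorem4p8:
  fixes D :: "('a, 'o::complete_heyting) hstruct" (structure)
    and B :: "'a \<Rightarrow> 'o"
  assumes "hstructure D"
    and "B \<in> subsets D"
  shows "valid
    ((dcpo D \<^bold>\<and> basis D B \<^bold>\<and>
      ((\<^bold>\<forall>a\<^bold>\<in>B. \<^bold>\<forall>b\<^bold>\<in>B. \<^bold>\<not> \<^bold>\<not> (a \<lless> b) \<^bold>\<longrightarrow> a \<lless> b) \<^bold>\<or>
       (\<^bold>\<forall>a\<^bold>\<in>B. \<^bold>\<forall>b\<^bold>\<in>B. \<^bold>\<not> \<^bold>\<not> (a \<sqsubseteq> b) \<^bold>\<longrightarrow> a \<sqsubseteq> b) \<^bold>\<or>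
       (\<^bold>\<forall>a\<^bold>\<in>B. \<^bold>\<forall>b\<^bold>\<in>B. decidable (a \<lless> b)) \<^bold>\<or>
       (\<^bold>\<forall>a\<^bold>\<in>B. \<^bold>\<forall>b\<^bold>\<in>B. decidable (a \<sqsubseteq> b))))
     \<^bold>\<longrightarrow>
     (nn_stable_basis D (scott_open D) (\<lambda>U. \<^bold>\<exists>b\<^bold>\<in>B. U \<^bold>= up_way D b) \<^bold>\<and>
      (\<^bold>\<forall>U\<^bold>\<subseteq>D. scott_open D U \<^bold>\<longleftrightarrow> apartness_open D (scott_open D) (intrinsic_apart D) U) \<^bold>\<and>
      (\<^bold>\<forall>U\<^bold>\<subseteq>D. nn_stable D (scott_open D) U \<^bold>\<longrightarrow>
         (scott_open D U \<^bold>\<longleftrightarrow> nearly_open D (scott_open D) (intrinsic_apart D) U))))"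
  unfolding valid_def
\<comment> \<open>The implication reduces to an arbitrary stage \<open>w\<close> forcing the
  hypotheses, at which the locale can be interpreted.\<close>
proof (rule top_le, rule himpI)
  fix w assume w: "w \<le> (dcpo D \<^bold>\<and> basis D B \<^bold>\<and>
      ((\<^bold>\<forall>a\<^bold>\<in>B. \<^bold>\<forall>b\<^bold>\<in>B. \<^bold>\<not> \<^bold>\<not> (a \<lless> b) \<^bold>\<longrightarrow> a \<lless> b) \<^bold>\<or>
       (\<^bold>\<forall>a\<^bold>\<in>B. \<^bold>\<forall>b\<^bold>\<in>B. \<^bold>\<not> \<^bold>\<not> (a \<sqsubseteq> b) \<^bold>\<longrightarrow> a \<sqsubseteq> b) \<^bold>\<or>
       (\<^bold>\<forall>a\<^bold>\<in>B. \<^bold>\<forall>b\<^bold>\<in>B. decidable (a \<lless> b)) \<^bold>\<or>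
       (\<^bold>\<forall>a\<^bold>\<in>B. \<^bold>\<forall>b\<^bold>\<in>B. decidable (a \<sqsubseteq> b))))"
  interpret stable_based_at_stage D B w
    by unfold_locales (use assms w in \<open>simp_all add: le_inf_iff\<close>)
  let ?T = "scott_open D" and ?R = "intrinsic_apart D"
  show "w \<le> (nn_stable_basis D ?T (\<lambda>U. \<^bold>\<exists>b\<^bold>\<in>B. U \<^bold>= up_way D b) \<^bold>\<and>
      (\<^bold>\<forall>U\<^bold>\<subseteq>D. ?T U \<^bold>\<longleftrightarrow> apartness_open D ?T ?R U) \<^bold>\<and>
      (\<^bold>\<forall>U\<^bold>\<subseteq>D. nn_stable D ?T U \<^bold>\<longrightarrow> (?T U \<^bold>\<longleftrightarrow> nearly_open D ?T ?R U)))"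
    unfolding le_inf_iff
  proof (intro conjI nn_stable_basis_up_way hball_subI)
    fix U assume U: "U \<in> subsets D"
    show "w \<le> (?T U \<^bold>\<longleftrightarrow> apartness_open D ?T ?R U)"
      unfolding hiff_def le_inf_iff
      by (auto intro!: himpI
          intro: apartness_open_imp_scott_open[OF U] scott_open_imp_apartness_open[OF U])
    show "w \<le> (nn_stable D ?T U \<^bold>\<longrightarrow> (?T U \<^bold>\<longleftrightarrow> nearly_open D ?T ?R U))"
    proof (rule himpI)
      fix q assume "q \<le> nn_stable D ?T U"
      then show "q \<le> (?T U \<^bold>\<longleftrightarrow> nearly_open D ?T ?R U)"
        unfolding hiff_def le_inf_iff
        by (auto intro!: himpI intro: nearly_open_imp_scott_open[OF U]
            nn_stable_open_imp_nearly_open[OF U] order_trans)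
    qed
  qed
qed

end
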